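(* Let $m, n$ be positive integers with $n$ even, and let $k$ be an odd integer with $k \geq -f_{n-2}(m) + 1$. Put $f_h = f_h(m)$, $$s = f_n f_{n-1} + k f_{n+1}, \quad t = -f_{n-1}^2 - k f_n, \quad D = s^2 - 4t, \quad T_n = f_{n+1} s + 2 f_n.$$ Let $(x,y)$ be the minimal solution of the negative Pell equation $X^2 - DY^2 = -1$. Then: (a) if $m$ is even, $x = \frac{(T_n^2+3)T_n}{2}$ and $y = \frac{(T_n^2+1) f_{n+1}}{2}$; (b) if $m$ is odd and $n \equiv 0, 4 \pmod 6$, $x = \frac{(T_n^2+3)T_n}{2}$ and $y = \frac{(T_n^2+1) f_{n+1}}{2}$; (c) if $m$ is odd and $n \equiv 2 \pmod 6$, $x = \frac{T_n}{2}$ and $y = \frac{f_{n+1}}{2}$.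
   Context: The Fibonacci polynomials $f_h(m)$, for a fixed integer $m$, are defined by $f_0(m) = 0$, $f_1(m) = 1$, $f_h(m) = m f_{h-1}(m) + f_{h-2}(m)$ for $h \geq 2$, and $f_{-h}(m) = (-1)^{h-1} f_h(m)$ for $h \geq 1$. The minimal solution of $X^2 - DY^2 = c$ is its solution in positive integers $(x,y)$ with $x+y\sqrt D$ smallest. *)

theory Defs
  imports Complex_Main
begin

fun fib_poly_nat :: "int \<Rightarrow> nat \<Rightarrow> int" where
  "fib_poly_nat m 0 = 0"
| "fib_poly_nat m (Suc 0) = 1"
| "fib_poly_nat m (Suc (Suc h)) = m * fib_poly_nat m (Suc h) + fib_poly_nat m h"

(* For h < 0 the index is -j with j = -h \<ge> 1, and the value is (-1)^(j-1) f_j(m). *)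
definition fib_poly :: "int \<Rightarrow> int \<Rightarrow> int" where
  "fib_poly m h =
     (if h \<ge> 0 then fib_poly_nat m (nat h)
      else (-1) ^ nat (- h - 1) * fib_poly_nat m (nat (- h)))"

definition pell_solution :: "int \<Rightarrow> int \<Rightarrow> int \<Rightarrow> int \<Rightarrow> bool" where
  "pell_solution D c x y \<longleftrightarrow> x > 0 \<and> y > 0 \<and> x\<^sup>2 - D * y\<^sup>2 = c"

definition minimal_pell_solution :: "int \<Rightarrow> int \<Rightarrow> int \<Rightarrow> int \<Rightarrow> bool" where
  "minimal_pell_solution D c x y \<longleftrightarrow>
     pell_solution D c x y \<and>
     (\<forall>x' y'. pell_solution D c x' y' \<longrightarrow>
        real_of_int x + real_of_int y * sqrt (real_of_int D)
          \<le> real_of_int x' + real_of_int y' * sqrt (real_of_int D))"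

end

theory Submission
  imports Defs
begin

text \<open>
  Put \<open>a = f (n - 1)\<close>, \<open>b = f n\<close>, \<open>c = f (n + 1)\<close> and \<open>j = k + f (n - 2)\<close>, so that \<open>j \<ge> 1\<close>. Cassini's
  identity \<open>a c = b\<^sup>2 + 1\<close> turns the data into \<open>s = m + c j\<close> and \<open>D = s\<^sup>2 + 4 (j b + 1)\<close>, and gives
  \<open>T\<^sup>2 - D c\<^sup>2 = -4\<close>. If \<open>U\<^sup>2 - D V\<^sup>2 = -4\<close> with \<open>V > 0\<close>, then \<open>\<bar>U\<bar> = s V + 2 q\<close> with \<open>q \<ge> 0\<close>, and
  \<open>w = c q - b V\<close> satisfies \<open>w (c\<^sup>2 j V + m c V + 2 b V + w) = V\<^sup>2 - c\<^sup>2\<close>, which forces \<open>V \<ge> c\<close>.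
  Hence \<open>\<epsilon> = (T + c \<surd>D) / 2\<close> is the least element of norm \<open>-1\<close>. If \<open>c\<close> is even, \<open>\<epsilon>\<close> is integral and
  is the minimal solution. If \<open>c\<close> is odd, multiplying a solution strictly between \<open>\<epsilon>\<close> and \<open>\<epsilon>\<^sup>3\<close>
  by \<open>\<epsilon>\<^sup>-\<^sup>2\<close> would give \<open>0 < V < c\<close>, so the minimal solution is \<open>\<epsilon>\<^sup>3\<close>.
\<close>

section \<open>Positivity, Cassini's identity and parity of Fibonacci polynomials\<close>

lemma fib_poly_nat_pos:
  assumes "m > 0"
  shows "fib_poly_nat m (Suc h) > 0"
proof -
  have "fib_poly_nat m h \<ge> 0 \<and> fib_poly_nat m (Suc h) > 0"
    using assms by (induction h) (auto simp: add_pos_nonneg)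
  then show ?thesis ..
qed

lemma fib_poly_nat_cassini:
  "fib_poly_nat m (Suc (Suc h)) * fib_poly_nat m h - (fib_poly_nat m (Suc h))\<^sup>2 = (-1) ^ Suc h"
proof (induction h)
  case (Suc h)
  define a b where "a = fib_poly_nat m h" and "b = fib_poly_nat m (Suc h)"
  have "(m * b + a) * a - b\<^sup>2 = (-1) ^ Suc h"
    using Suc by (simp add: a_def b_def)
  then have "(m * (m * b + a) + b) * b - (m * b + a)\<^sup>2 = - ((-1) ^ Suc h)"
    by (simp add: algebra_simps power2_eq_square)
  then show ?case
    by (simp add: a_def b_def)
qed simp

text \<open>Modulo 2 the recurrence becomes f_(h+2) = f_h, so the values alternate 0, 1.\<close>

lemma even_fib_poly_nat_even:
  assumes "even m"
  shows "even (fib_poly_nat m h) \<longleftrightarrow> even h"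
  using assms by (induction m h rule: fib_poly_nat.induct) auto

text \<open>Modulo 2 the recurrence is that of the Fibonacci numbers, with period 0, 1, 1. The
  induction carries two consecutive indices because the recurrence has order two.\<close>

lemma even_fib_poly_nat_odd:
  assumes "odd m"
  shows "even (fib_poly_nat m h) \<longleftrightarrow> h mod 3 = 0"
proof -
  have "(even (fib_poly_nat m h) \<longleftrightarrow> h mod 3 = 0) \<and>
        (even (fib_poly_nat m (Suc h)) \<longleftrightarrow> Suc h mod 3 = 0)"
  proof (induction h)
    case (Suc h)
    have "even (fib_poly_nat m (Suc (Suc h))) \<longleftrightarrow> (Suc h mod 3 = 0 \<longleftrightarrow> h mod 3 = 0)"
      using Suc assms by simp
    also have "\<dots> \<longleftrightarrow> Suc (Suc h) mod 3 = 0"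
      by presburger
    finally show ?case
      by (rule conjI[OF conjunct2[OF Suc.IH]])
  qed simp
  then show ?thesis ..
qed

section \<open>Lower bounds for solutions of norm -4 and -1\<close>

lemma pell_minus_four_lower_bound:
  fixes b c j m s D U V :: int
  assumes pos: "b > 0" "c > 0" "j > 0" "m > 0"
    and rel: "c\<^sup>2 - m * b * c - b\<^sup>2 = 1"
    and s: "s = m + c * j" and D: "D = s\<^sup>2 + 4 * (j * b + 1)"
    and pell: "U\<^sup>2 - D * V\<^sup>2 = -4" and V: "V > 0"
  shows "c \<le> V"
proof -
  define r where "r = \<bar>U\<bar> - s * V"
  have U: "\<bar>U\<bar> = s * V + r"
    by (simp add: r_def)
  have "(s * V + r)\<^sup>2 - D * V\<^sup>2 = -4"
    using pell U by (metis power2_abs)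
  then have r: "2 * s * r * V + r\<^sup>2 = 4 * ((j * b + 1) * V\<^sup>2 - 1)"
    unfolding D by (simp add: algebra_simps power2_eq_square)
  then have "r\<^sup>2 = 2 * (2 * ((j * b + 1) * V\<^sup>2 - 1) - s * r * V)"
    by (simp add: algebra_simps)
  then have "even (r\<^sup>2)"
    by (metis dvd_triv_left)
  then have "even r"
    by simp
  then obtain q where q: "r = 2 * q" ..
  \<comment> \<open>Since U^2 = (s V)^2 + 4 ((j b + 1) V^2 - 1), these bounds give |U| >= s V, that
    is, q >= 0.\<close>
  have "j * b + 1 \<ge> 1" "V\<^sup>2 \<ge> 1"
    using pos V by (simp_all add: int_one_le_iff_zero_less)
  then have "(j * b + 1) * V\<^sup>2 \<ge> 1 * 1"
    by (intro mult_mono) auto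
  then have "(s * V)\<^sup>2 \<le> U\<^sup>2"
    using pell unfolding D by (simp add: algebra_simps power2_eq_square)
  then have "s * V \<le> \<bar>U\<bar>"
    using abs_le_square_iff[of "s * V" U] by linarith
  then have q_nonneg: "q \<ge> 0"
    using U q by simp
  have main: "s * q * V + q\<^sup>2 + 1 = (j * b + 1) * V\<^sup>2"
    using r unfolding q by (simp add: algebra_simps power2_eq_square)
  \<comment> \<open>By \<open>rel\<close>, q = b and V = c satisfy the equation \<open>main\<close>;
    \<open>w\<close> measures how far (q, V) is from being proportional to (b, c). Multiplying
    \<open>main\<close> by c^2 and applying \<open>rel\<close> leaves the factorization
    \<open>w * K\<close>.\<close>
  define w where "w = c * q - b * V"
  define K where "K = c\<^sup>2 * j * V + m * c * V + b * V + c * q"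
  have "w * K - (V\<^sup>2 - c\<^sup>2)
      = c\<^sup>2 * (s * q * V + q\<^sup>2 + 1 - (j * b + 1) * V\<^sup>2) + V\<^sup>2 * (c\<^sup>2 - m * b * c - b\<^sup>2 - 1)"
    unfolding w_def K_def s by (simp add: algebra_simps power2_eq_square)
  then have wK: "w * K = V\<^sup>2 - c\<^sup>2"
    using main rel by simp
  have nonneg: "m * c * V \<ge> 0" "b * V \<ge> 0" "c * q \<ge> 0"
    using pos V q_nonneg by simp_all
  have "j * V \<ge> 1"
    using pos V by (simp add: int_one_le_iff_zero_less)
  then have "c\<^sup>2 * 1 \<le> c\<^sup>2 * (j * V)"
    by (intro mult_left_mono) auto
  then have K: "K \<ge> c\<^sup>2"
    unfolding K_def using nonneg by (simp add: mult.assoc)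
  \<comment> \<open>If w <= -1, then K >= c^2 gives c^2 <= -w K = c^2 - V^2, which is impossible for
    V > 0.\<close>
  have "w \<ge> 0"
  proof (rule ccontr)
    assume "\<not> w \<ge> 0"
    then have "1 * c\<^sup>2 \<le> (- w) * K"
      using K by (intro mult_mono) auto
    then have "V\<^sup>2 \<le> 0"
      using wK by simp
    then show False
      using V by simp
  qed
  moreover have "K \<ge> 0"
    using K zero_le_power2[of c] by linarith
  ultimately have "w * K \<ge> 0"
    by simp
  then have "c\<^sup>2 \<le> V\<^sup>2"
    using wK by simp
  then show ?thesis
    using V by - (rule power2_le_imp_le, auto)
qed

text \<open>With \<epsilon> = (T + c sqrt D)/2, the cube \<epsilon>^3 is ((T^2 + 3) T + (T^2 + 1) c
  sqrt D)/2, whence the bound. It follows by dividing x + y sqrt D by \<epsilon>^2 and applying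
  \<open>least\<close> to the quotient.\<close>

lemma pell_odd_lower_bound:
  fixes c D T x y :: int
  assumes "c > 0" "T > 0" "odd c"
    and norm: "T\<^sup>2 - D * c\<^sup>2 = -4"
    and least: "\<And>U V. U\<^sup>2 - D * V\<^sup>2 = -4 \<Longrightarrow> V > 0 \<Longrightarrow> c \<le> V"
    and pell: "x\<^sup>2 - D * y\<^sup>2 = -1" and x: "x > 0" and y: "y > 0"
  shows "(T\<^sup>2 + 1) * c \<le> 2 * y"
proof -
  have "(2 * x)\<^sup>2 - D * (2 * y)\<^sup>2 = -4"
    using pell by (simp add: power2_eq_square)
  then have "c \<le> 2 * y"
    using y by (intro least[of "2 * x" "2 * y"]) simp_all
  with \<open>odd c\<close> have c_less: "c < 2 * y"
    by presburger
  \<comment> \<open>By \<open>norm\<close>, \<epsilon>^2 = (A + B sqrt D)/2, an element of norm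
    1.\<close>
  define A B where "A = T\<^sup>2 + 2" and "B = T * c"
  have "A\<^sup>2 - D * B\<^sup>2 - 4 = T\<^sup>2 * (T\<^sup>2 - D * c\<^sup>2 + 4)"
    unfolding A_def B_def by (simp add: algebra_simps power2_eq_square)
  then have AB: "A\<^sup>2 = D * B\<^sup>2 + 4"
    using norm by simp
  have AB_pos: "A > 0" "B > 0"
    using assms by (simp_all add: A_def B_def add_nonneg_pos)
  \<comment> \<open>(U + V sqrt D)/2 is x + y sqrt D times the conjugate (A - B sqrt D)/2, which is
    \<epsilon>^(-2).\<close>
  define U V where "U = A * x - D * B * y" and "V = A * y - B * x"
  have "U\<^sup>2 - D * V\<^sup>2 = (A\<^sup>2 - D * B\<^sup>2) * (x\<^sup>2 - D * y\<^sup>2)"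
    unfolding U_def V_def by (simp add: algebra_simps power2_eq_square)
  then have UV: "U\<^sup>2 - D * V\<^sup>2 = -4"
    using AB pell by simp
  have "(A * y)\<^sup>2 = (D * B\<^sup>2 + 4) * y\<^sup>2"
    by (simp add: power_mult_distrib AB)
  also have "\<dots> = B\<^sup>2 * (D * y\<^sup>2) + 4 * y\<^sup>2"
    by (simp add: algebra_simps)
  also have "D * y\<^sup>2 = x\<^sup>2 + 1"
    using pell by simp
  finally have Ay: "(A * y)\<^sup>2 = (B * x)\<^sup>2 + B\<^sup>2 + 4 * y\<^sup>2"
    by (simp add: algebra_simps)
  have "B\<^sup>2 > 0" "y\<^sup>2 > 0"
    using AB_pos y by simp_all
  then have "(B * x)\<^sup>2 < (A * y)\<^sup>2"
    using Ay by linarith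
  then have "B * x < A * y"
    using AB_pos y by - (rule power2_less_imp_less, auto)
  then have "c \<le> V"
    using least[OF UV] by (simp add: V_def)
  then have "(B * x)\<^sup>2 \<le> (A * y - c)\<^sup>2"
    using AB_pos x by - (rule power_mono, auto simp: V_def)
  then have "0 \<le> 4 * y\<^sup>2 - 2 * A * y * c + c\<^sup>2 + B\<^sup>2"
    using Ay by (simp add: power2_diff algebra_simps)
  \<comment> \<open>The roots in 2y are the coordinates of \<epsilon> and \<epsilon>^3. The first
    factor is positive because the odd c cannot equal 2y, so the second is nonnegative.\<close>
  also have "\<dots> = (2 * y - c) * (2 * y - (T\<^sup>2 + 1) * c)"
    unfolding A_def B_def by (simp add: algebra_simps power2_eq_square)
  finally show ?thesis
    using c_less by (simp add: zero_le_mult_iff)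
qed

section \<open>From bounds on y to minimal solutions\<close>

text \<open>As x^2 = c + D y^2 increases with y, a solution with least y has least x too, so x + y
  sqrt D is also least. This reduces minimality over the reals to an integer inequality.\<close>

lemma minimal_pell_solution_iff_least_y:
  assumes sol: "pell_solution D c x\<^sub>0 y\<^sub>0" and "D > 0"
    and least: "\<And>x y. pell_solution D c x y \<Longrightarrow> y\<^sub>0 \<le> y"
  shows "minimal_pell_solution D c x y \<longleftrightarrow> x = x\<^sub>0 \<and> y = y\<^sub>0"
proof -
  have x_le: "x\<^sub>0 \<le> x'" if "pell_solution D c x' y'" for x' y'
  proof -
    have "y\<^sub>0\<^sup>2 \<le> y'\<^sup>2"
      using least[OF that] sol by - (rule power_mono, auto simp: pell_solution_def)
    then have "D * y\<^sub>0\<^sup>2 \<le> D * y'\<^sup>2"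
      using \<open>D > 0\<close> by simp
    then have "x\<^sub>0\<^sup>2 \<le> x'\<^sup>2"
      using sol that unfolding pell_solution_def by linarith
    then show ?thesis
      using that by - (rule power2_le_imp_le, auto simp: pell_solution_def)
  qed
  have sqrt_pos: "sqrt (real_of_int D) > 0"
    using \<open>D > 0\<close> by simp
  have y_le: "real_of_int y\<^sub>0 * sqrt D \<le> real_of_int y' * sqrt D"
    if "pell_solution D c x' y'" for x' y'
    using least[OF that] sqrt_pos by simp
  show ?thesis
  proof
    assume min: "minimal_pell_solution D c x y"
    then have xy: "pell_solution D c x y"
      by (simp add: minimal_pell_solution_def)
    have "real_of_int x + y * sqrt D \<le> x\<^sub>0 + y\<^sub>0 * sqrt D"
      using min sol by (simp add: minimal_pell_solution_def)
    \<comment> \<open>Each summand is at least its counterpart while the sum is at most the other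
      sum, so both agree.\<close>
    then have "x = x\<^sub>0" "y * sqrt D = y\<^sub>0 * sqrt D"
      using x_le[OF xy] y_le[OF xy] by linarith+
    then show "x = x\<^sub>0 \<and> y = y\<^sub>0"
      using sqrt_pos by simp
  next
    assume "x = x\<^sub>0 \<and> y = y\<^sub>0"
    moreover have "real_of_int x\<^sub>0 + y\<^sub>0 * sqrt D \<le> x' + y' * sqrt D"
      if "pell_solution D c x' y'" for x' y'
      using x_le[OF that] y_le[OF that] by - (rule add_mono, auto)
    ultimately show "minimal_pell_solution D c x y"
      using sol by (simp add: minimal_pell_solution_def)
  qed
qed

text \<open>Here (T + c sqrt D)/2 has integer coordinates, and doubling any competitor gives a
  solution of norm -4 to which \<open>least\<close> applies.\<close>

lemma minimal_pell_solution_even: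
  fixes c D T x y :: int
  assumes "c > 0" "T > 0" "D > 0" "even c" "even T"
    and norm: "T\<^sup>2 - D * c\<^sup>2 = -4"
    and least: "\<And>U V. U\<^sup>2 - D * V\<^sup>2 = -4 \<Longrightarrow> V > 0 \<Longrightarrow> c \<le> V"
  shows "minimal_pell_solution D (-1) x y \<longleftrightarrow> x = T div 2 \<and> y = c div 2"
proof -
  obtain x\<^sub>0 where x\<^sub>0: "T = 2 * x\<^sub>0"
    using \<open>even T\<close> ..
  obtain y\<^sub>0 where y\<^sub>0: "c = 2 * y\<^sub>0"
    using \<open>even c\<close> ..
  have "x\<^sub>0\<^sup>2 - D * y\<^sub>0\<^sup>2 = -1"
    using norm unfolding x\<^sub>0 y\<^sub>0 power_mult_distrib by simp
  then have sol: "pell_solution D (-1) x\<^sub>0 y\<^sub>0"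
    using \<open>T > 0\<close> \<open>c > 0\<close> x\<^sub>0 y\<^sub>0 by (simp add: pell_solution_def)
  have "y\<^sub>0 \<le> y'" if "pell_solution D (-1) x' y'" for x' y'
    using least[of "2 * x'" "2 * y'"] that y\<^sub>0
    by (simp add: pell_solution_def power_mult_distrib)
  then have "minimal_pell_solution D (-1) x y \<longleftrightarrow> x = x\<^sub>0 \<and> y = y\<^sub>0"
    by (rule minimal_pell_solution_iff_least_y[OF sol \<open>D > 0\<close>])
  then show ?thesis
    by (simp add: x\<^sub>0 y\<^sub>0)
qed

text \<open>The pair is the cube of (T + c sqrt D)/2. Its coordinates are integers since T^2 + 3 and
  T^2 + 1 are even, and its norm is (-1)^3 = -1.\<close>

lemma minimal_pell_solution_odd:
  fixes c D T x y :: int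
  assumes "c > 0" "T > 0" "D > 0" "odd c" "odd T"
    and norm: "T\<^sup>2 - D * c\<^sup>2 = -4"
    and least: "\<And>U V. U\<^sup>2 - D * V\<^sup>2 = -4 \<Longrightarrow> V > 0 \<Longrightarrow> c \<le> V"
  shows "minimal_pell_solution D (-1) x y \<longleftrightarrow>
    x = (T\<^sup>2 + 3) * T div 2 \<and> y = (T\<^sup>2 + 1) * c div 2"
proof -
  define x\<^sub>0 y\<^sub>0 where "x\<^sub>0 = (T\<^sup>2 + 3) * T div 2" and "y\<^sub>0 = (T\<^sup>2 + 1) * c div 2"
  have x\<^sub>0: "2 * x\<^sub>0 = (T\<^sup>2 + 3) * T" and y\<^sub>0: "2 * y\<^sub>0 = (T\<^sup>2 + 1) * c"
    using \<open>odd T\<close> by (simp_all add: x\<^sub>0_def y\<^sub>0_def)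
  have "2 * x\<^sub>0 > 0" "2 * y\<^sub>0 > 0"
    unfolding x\<^sub>0 y\<^sub>0 using \<open>T > 0\<close> \<open>c > 0\<close> by (simp_all add: add_nonneg_pos)
  moreover have "x\<^sub>0\<^sup>2 - D * y\<^sub>0\<^sup>2 = -1"
  proof -
    have "4 * (x\<^sub>0\<^sup>2 - D * y\<^sub>0\<^sup>2) = (2 * x\<^sub>0)\<^sup>2 - D * (2 * y\<^sub>0)\<^sup>2"
      by (simp add: algebra_simps power2_eq_square)
    also have "\<dots> = (T\<^sup>2 + 3)\<^sup>2 * T\<^sup>2 - (T\<^sup>2 + 1)\<^sup>2 * (D * c\<^sup>2)"
      unfolding x\<^sub>0 y\<^sub>0 by (simp only: power_mult_distrib mult_ac)
    also have "D * c\<^sup>2 = T\<^sup>2 + 4"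
      using norm by simp
    also have "(T\<^sup>2 + 3)\<^sup>2 * T\<^sup>2 - (T\<^sup>2 + 1)\<^sup>2 * (T\<^sup>2 + 4) = -4"
      by (simp add: algebra_simps power2_eq_square)
    finally show ?thesis
      by simp
  qed
  ultimately have sol: "pell_solution D (-1) x\<^sub>0 y\<^sub>0"
    by (simp add: pell_solution_def)
  have "y\<^sub>0 \<le> y'" if "pell_solution D (-1) x' y'" for x' y'
  proof -
    have "(T\<^sup>2 + 1) * c \<le> 2 * y'"
      using \<open>c > 0\<close> \<open>T > 0\<close> \<open>odd c\<close> norm least
      by (rule pell_odd_lower_bound[where x = x']) (use that in \<open>simp_all add: pell_solution_def\<close>)
    then show ?thesis
      using y\<^sub>0 by linarith
  qed
  then have "minimal_pell_solution D (-1) x y \<longleftrightarrow> x = x\<^sub>0 \<and> y = y\<^sub>0"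
    by (rule minimal_pell_solution_iff_least_y[OF sol \<open>D > 0\<close>])
  then show ?thesis
    by (simp only: x\<^sub>0_def y\<^sub>0_def)
qed

section \<open>The Fibonacci data and the theorem\<close>

text \<open>Here a, b, c stand for f_(n-1), f_n, f_(n+1), and b - m a is f_(n-2). Cassini's identity
  is the only further relation between them, so the claims become polynomial identities.\<close>

lemma pell_minus_four_cassini:
  fixes a b c j k m s t D T :: int
  assumes pos: "m > 0" "j > 0" "b > 0" "c > 0" and "odd k"
    and c: "c = m * b + a" and cassini: "c * a = b\<^sup>2 + 1" and k: "k = j - (b - m * a)"
    and s_def: "s = b * a + k * c" and t_def: "t = - a\<^sup>2 - k * b"
    and D_def: "D = s\<^sup>2 - 4 * t" and T_def: "T = c * s + 2 * b"
  shows "T > 0" and "D > 0" and "even T \<longleftrightarrow> even c" and "T\<^sup>2 - D * c\<^sup>2 = -4"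
    and "\<And>U V. U\<^sup>2 - D * V\<^sup>2 = -4 \<Longrightarrow> V > 0 \<Longrightarrow> c \<le> V"
proof -
  have rel: "c\<^sup>2 - m * b * c - b\<^sup>2 = 1"
  proof -
    have "c\<^sup>2 - m * b * c = c * a"
      by (simp add: c algebra_simps power2_eq_square)
    then show ?thesis
      using cassini by simp
  qed
  have cas: "m * b * a + a\<^sup>2 = b\<^sup>2 + 1"
    using cassini unfolding c by (simp add: algebra_simps power2_eq_square)
  have "s - (m + c * j) = m * (m * b * a + a\<^sup>2 - b\<^sup>2 - 1)"
    unfolding s_def k c by (simp add: algebra_simps power2_eq_square)
  then have s: "s = m + c * j"
    using cas by simp
  have "- t - (j * b + 1) = m * b * a + a\<^sup>2 - b\<^sup>2 - 1"
    unfolding t_def k by (simp add: algebra_simps power2_eq_square)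
  then have D: "D = s\<^sup>2 + 4 * (j * b + 1)"
    using cas unfolding D_def by simp
  have "s > 0"
    using pos by (simp add: s add_pos_pos)
  then show "T > 0" "D > 0"
    using pos by (simp_all add: T_def D add_pos_pos)
  show "even T \<longleftrightarrow> even c"
  proof
    assume "even T"
    \<comment> \<open>For odd c, the identity c a = b^2 + 1 gives a and b opposite parity, so b a is
      even, while k c is odd because k is.\<close>
    moreover have "odd s" if "odd c"
      using arg_cong[OF cassini, of even] that \<open>odd k\<close> by (auto simp: s_def)
    ultimately show "even c"
      by (auto simp: T_def)
  qed (simp add: T_def)
  have "T\<^sup>2 - D * c\<^sup>2 + 4 = 4 * (1 - (c\<^sup>2 - m * b * c - b\<^sup>2))"
    unfolding T_def D s by (simp add: algebra_simps power2_eq_square)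
  then show "T\<^sup>2 - D * c\<^sup>2 = -4"
    using rel by simp
  show "c \<le> V" if "U\<^sup>2 - D * V\<^sup>2 = -4" "V > 0" for U V
    using pell_minus_four_lower_bound[OF pos(3,4,2,1) rel s D that] .
qed

text \<open>The cases are governed by the parity of f_(n+1). Existence is asserted so that the
  formulas do not hold vacuously, and halves are taken in the reals so that no rounding is
  hidden.\<close>

theorem theorem4p2:
  fixes m n k s t D T :: int and f :: "int \<Rightarrow> int"
  assumes "m > 0" and "n > 0" and "even n"
    and f_def: "\<And>h. f h = fib_poly m h"
    and "odd k" and "k \<ge> - f (n - 2) + 1"
    and s_def: "s = f n * f (n - 1) + k * f (n + 1)"
    and t_def: "t = - (f (n - 1))\<^sup>2 - k * f n"
    and D_def: "D = s\<^sup>2 - 4 * t"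
    and T_def: "T = f (n + 1) * s + 2 * f n"
  shows "(\<exists>x y. minimal_pell_solution D (-1) x y) \<and>
    (\<forall>x y. minimal_pell_solution D (-1) x y \<longrightarrow>
      (even m \<longrightarrow>
        real_of_int x = real_of_int ((T\<^sup>2 + 3) * T) / 2 \<and>
        real_of_int y = real_of_int ((T\<^sup>2 + 1) * f (n + 1)) / 2) \<and>
      (odd m \<and> (n mod 6 = 0 \<or> n mod 6 = 4) \<longrightarrow>
        real_of_int x = real_of_int ((T\<^sup>2 + 3) * T) / 2 \<and>
        real_of_int y = real_of_int ((T\<^sup>2 + 1) * f (n + 1)) / 2) \<and>
      (odd m \<and> n mod 6 = 2 \<longrightarrow>
        real_of_int x = real_of_int T / 2 \<and>
        real_of_int y = real_of_int (f (n + 1)) / 2))"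
proof -
  have "n \<ge> 2"
    using \<open>n > 0\<close> \<open>even n\<close> by presburger
  obtain h where n: "n = int (Suc (Suc h))" and "even h"
  proof
    show "n = int (Suc (Suc (nat (n - 2))))" "even (nat (n - 2))"
      using \<open>n \<ge> 2\<close> \<open>even n\<close> by (simp_all add: even_nat_iff)
  qed
  define a b c where "a = f (n - 1)" and "b = f n" and "c = f (n + 1)"
  have f_nat: "f (int i) = fib_poly_nat m i" for i
    by (simp add: f_def fib_poly_def)
  have idx: "n - 2 = int h" "n - 1 = int (Suc h)" "n + 1 = int (Suc (Suc (Suc h)))"
    by (simp_all add: n)
  have F: "f (n - 2) = fib_poly_nat m h" "a = fib_poly_nat m (Suc h)"
      "b = fib_poly_nat m (Suc (Suc h))" "c = fib_poly_nat m (Suc (Suc (Suc h)))"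
    using f_nat[of h] f_nat[of "Suc h"] f_nat[of "Suc (Suc h)"] f_nat[of "Suc (Suc (Suc h))"]
    unfolding idx[symmetric] n[symmetric] a_def b_def c_def by blast+
  have pos: "b > 0" "c > 0"
    unfolding F using \<open>m > 0\<close> by (rule fib_poly_nat_pos)+
  have f_rec: "b = m * a + f (n - 2)" and c: "c = m * b + a"
    unfolding F by simp_all
  \<comment> \<open>Cassini at index h + 1 has sign (-1)^(h+2), which is +1 because h is
    even.\<close>
  have cassini: "c * a = b\<^sup>2 + 1"
    using fib_poly_nat_cassini[of m "Suc h"] \<open>even h\<close> by (simp add: F)
  have k: "k = (k + f (n - 2)) - (b - m * a)" and j: "k + f (n - 2) > 0"
    using f_rec \<open>k \<ge> - f (n - 2) + 1\<close> by simp_all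
  have s: "s = b * a + k * c" and t: "t = - a\<^sup>2 - k * b" and T: "T = c * s + 2 * b"
    by (simp_all add: s_def t_def T_def a_def b_def c_def)
  note core = pell_minus_four_cassini[OF \<open>m > 0\<close> j pos \<open>odd k\<close> c cassini k s t D_def T]
  have even_case: "minimal_pell_solution D (-1) x y \<longleftrightarrow> x = T div 2 \<and> y = c div 2"
    if "even c" for x y
    using core(3) that by (intro minimal_pell_solution_even pos core) simp_all
  have odd_case: "minimal_pell_solution D (-1) x y \<longleftrightarrow>
      x = (T\<^sup>2 + 3) * T div 2 \<and> y = (T\<^sup>2 + 1) * c div 2"
    if "odd c" for x y
    using core(3) that by (intro minimal_pell_solution_odd pos core) simp_all
  have half: "real_of_int (i div 2) = real_of_int i / 2" if "even i" for i
    using real_of_int_div[OF that] by simp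
  have ex: "\<exists>x y. minimal_pell_solution D (-1) x y"
    using even_case odd_case by (cases "even c") auto
  have even_result: "real_of_int x = real_of_int T / 2 \<and> real_of_int y = real_of_int c / 2"
    if "minimal_pell_solution D (-1) x y" "even c" for x y
    using that even_case core(3) half by simp
  have odd_result: "real_of_int x = real_of_int ((T\<^sup>2 + 3) * T) / 2 \<and>
      real_of_int y = real_of_int ((T\<^sup>2 + 1) * c) / 2"
    if "minimal_pell_solution D (-1) x y" "odd c" for x y
  proof -
    have "odd T"
      using core(3) \<open>odd c\<close> by simp
    then have "even ((T\<^sup>2 + 3) * T)" "even ((T\<^sup>2 + 1) * c)"
      by simp_all
    moreover have "x = (T\<^sup>2 + 3) * T div 2 \<and> y = (T\<^sup>2 + 1) * c div 2"
      using odd_case[OF \<open>odd c\<close>] that(1) by blast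
    ultimately show ?thesis
      by (simp only: half)
  qed
  have c_even_m: "odd c" if "even m"
    using even_fib_poly_nat_even[OF that, of "Suc (Suc (Suc h))"] \<open>even h\<close> unfolding F by simp
  have c_odd_m: "even c \<longleftrightarrow> h mod 3 = 0" if "odd m"
    unfolding F even_fib_poly_nat_odd[OF that] by presburger
  \<comment> \<open>Since h = n - 2 is even, divisibility of h by 6 and by 3 coincide.\<close>
  have n_mod: "n mod 6 = 2 \<longleftrightarrow> h mod 3 = 0"
  proof -
    have "n mod 6 = 2 \<longleftrightarrow> 6 dvd n - 2"
      using mod_eq_dvd_iff[of n 6 2] by simp
    also have "\<dots> \<longleftrightarrow> int 6 dvd int h"
      by (simp only: idx of_nat_numeral)
    also have "\<dots> \<longleftrightarrow> 2 * 3 dvd h"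
      by (simp only: int_dvd_int_iff) simp
    also have "\<dots> \<longleftrightarrow> h mod 3 = 0"
    proof -
      have "coprime (2::nat) 3"
        by simp
      then show ?thesis
        using \<open>even h\<close> by (metis divides_mult dvd_mult_right mod_0_imp_dvd dvd_imp_mod_0)
    qed
    finally show ?thesis .
  qed
  have odd_c: "odd c" if "n mod 6 = 0 \<or> n mod 6 = 4" "odd m"
    using that c_odd_m n_mod by auto
  have even_c: "even c" if "n mod 6 = 2" "odd m"
    using that c_odd_m n_mod by simp
  show ?thesis
    unfolding c_def[symmetric]
  proof (intro conjI[OF ex] allI conjI[OF impI conjI[OF impI impI]] impI, goal_cases)
    case (1 x y)
    then show ?case by (intro odd_result c_even_m)
  next
    case (2 x y)
    then show ?case by (intro odd_result odd_c) simp_all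
  next
    case (3 x y)
    then show ?case by (intro even_result even_c) simp_all
  qed
qed

end
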